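(* Let $r\in\mathbb{N}$. For any $m_1,\ldots,m_r\in \mathbb{N}$, $$E(m_1,\ldots,m_r)= \sum_{d_1\mid m_1, \ldots, d_r\mid m_r} \frac{d_1\cdots d_r}{\operatorname{lcm}[d_1,\ldots, d_r]}\, \mu(m_1/d_1)\cdots \mu(m_r/d_r),$$ where $E(m_1,\ldots,m_r)=\frac1{M}\sum_{k=1}^M c_{m_1}(k)\cdots c_{m_r}(k)$ and $M$ is any positive integer divisible by $\operatorname{lcm}[m_1,\ldots,m_r]$.
   Context: $\mathbb{N}=\{1,2,\ldots\}$. $\mu$ is the Möbius function. For $n,k\in\mathbb{N}$ the Ramanujan sum is $c_n(k)=\sum_{1\le j\le n,\ \gcd(j,n)=1}\exp(2\pi i jk/n)$. The sum in the claim runs over all $r$-tuples $(d_1,\ldots,d_r)$ of positive integers with $d_i\mid m_i$ for each $i$. *)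

theory Defs
  imports Complex_Main "HOL-Library.FuncSet" "HOL-Computational_Algebra.Computational_Algebra"
begin

definition moebius :: "nat \<Rightarrow> int" where
  "moebius n = (if squarefree n then (- 1) ^ card (prime_factors n) else 0)"

definition ramanujan_sum :: "nat \<Rightarrow> nat \<Rightarrow> complex" where
  "ramanujan_sum n k =
     (\<Sum>j | 1 \<le> j \<and> j \<le> n \<and> gcd j n = 1.
        exp (2 * of_real pi * \<i> * of_nat j * of_nat k / of_nat n))"

(* The mean over one common period M of the arguments m 1, ..., m r. The period is
   an explicit argument, so that nothing is presupposed about the choice of M. *)
definition ramanujan_mean :: "nat \<Rightarrow> nat \<Rightarrow> (nat \<Rightarrow> nat) \<Rightarrow> complex" where
  "ramanujan_mean M r m =
     1 / of_nat M * (\<Sum>k = 1..M. \<Prod>i = 1..r. ramanujan_sum (m i) k)"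

(* The r-tuples (d 1, ..., d r) with d i dvd m i, as functions that are undefined
   outside {1..r}, so that each tuple is represented exactly once. *)
definition divisor_tuples :: "nat \<Rightarrow> (nat \<Rightarrow> nat) \<Rightarrow> (nat \<Rightarrow> nat) set" where
  "divisor_tuples r m = (\<Pi>\<^sub>E i\<in>{1..r}. {d. d dvd m i})"

end

theory Submission
  imports Defs
begin

text \<open>Detecting \<open>gcd j n = 1\<close> by \<open>\<Sum>e dvd gcd j n. \<mu> e\<close> and summing the roots of unity gives
  \<open>c\<^sub>n(k) = (\<Sum>d dvd gcd n k. d \<mu>(n/d))\<close>. Expanding the product of these sums, the tuple \<open>d\<close>
  contributes exactly for those \<open>k\<close> that are multiples of \<open>lcm[d\<^sub>1,\<dots>,d\<^sub>r]\<close>, which form a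
  proportion \<open>1 / lcm[d\<^sub>1,\<dots>,d\<^sub>r]\<close> of \<open>{1..M}\<close>.\<close>

lemma moebius_Suc_0 [simp]: "moebius (Suc 0) = 1"
  by (simp add: moebius_def)

text \<open>A new prime factor raises the number of prime factors by one and preserves
  squarefreeness in both directions, so in the non-squarefree case both sides vanish.\<close>

lemma moebius_prime_times:
  assumes "prime p" and "\<not> p dvd n"
  shows "moebius (p * n) = - moebius n"
proof -
  have cop: "coprime p n"
    using assms by (simp add: prime_imp_coprime)
  have n: "n \<noteq> 0"
    using assms by (metis dvd_0_right)
  have "prime_factors (p * n) = insert p (prime_factors n)"
    using assms n by (simp add: prime_factors_product prime_prime_factors)
  moreover have "p \<notin> prime_factors n"
    using assms by (auto dest: in_prime_factors_imp_dvd)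
  moreover have "squarefree (p * n) \<longleftrightarrow> squarefree n"
    using cop assms squarefree_mult_coprime[of p n] squarefree_prime[of p] squarefree_multD(2)[of p n]
    by auto
  ultimately show ?thesis
    by (simp add: moebius_def)
qed

text \<open>For a prime \<open>p\<close> dividing \<open>n\<close>, multiplication by
  \<open>p\<close> matches the squarefree divisors prime to \<open>p\<close> (the set
  \<open>A\<close>) with those divisible by \<open>p\<close> (the set \<open>B\<close>) and flips
  the sign of \<open>moebius\<close>, so everything cancels.\<close>

lemma sum_moebius_divisors:
  assumes "n > 0"
  shows "(\<Sum>d | d dvd n. moebius d) = (if n = 1 then 1 else 0)"
proof (cases "n = 1")
  case False
  then obtain p where p: "prime p" "p dvd n"
    using prime_factor_nat by blast
  have fin: "finite {d. d dvd n}"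
    using assms by simp
  define A where "A = {d. d dvd n \<and> squarefree d \<and> \<not> p dvd d}"
  define B where "B = {d. d dvd n \<and> squarefree d \<and> p dvd d}"
  have finA: "finite A" and finB: "finite B"
    using finite_subset[OF _ fin] by (auto simp: A_def B_def)
  have B: "B = (*) p ` A"
  proof (intro equalityI subsetI)
    fix d assume "d \<in> B"
    then have d: "d dvd n" "squarefree d" "p dvd d"
      by (auto simp: B_def)
    then obtain e where e: "d = p * e" by auto
    have "\<not> p dvd e"
    proof
      assume "p dvd e"
      then have "p ^ 2 dvd d"
        by (simp add: e power2_eq_square)
      with d(2) have "p dvd 1"
        by (rule squarefreeD)
      with p(1) show False
        by simp
    qed
    moreover have "squarefree e" "e dvd n"
      using d e squarefree_multD(2)[of p e] by (auto dest: dvd_mult_right)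
    ultimately show "d \<in> (*) p ` A"
      by (auto simp: A_def e)
  next
    fix d assume "d \<in> (*) p ` A"
    then obtain e where e: "d = p * e" "e dvd n" "squarefree e" "\<not> p dvd e"
      by (auto simp: A_def)
    then have "coprime p e"
      using p by (simp add: prime_imp_coprime)
    then show "d \<in> B"
      using e p by (auto simp: B_def divides_mult squarefree_mult_coprime squarefree_prime)
  qed
  have "(\<Sum>d | d dvd n. moebius d) = sum moebius (A \<union> B)"
    by (rule sum.mono_neutral_right) (use fin in \<open>auto simp: A_def B_def moebius_def\<close>)
  also have "\<dots> = sum moebius A + sum moebius B"
    using finA finB by (intro sum.union_disjoint) (auto simp: A_def B_def)
  also have "sum moebius B = (\<Sum>d\<in>A. moebius (p * d))"
    unfolding B using p(1) by (subst sum.reindex) (auto simp: inj_on_def)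
  also have "\<dots> = (\<Sum>d\<in>A. - moebius d)"
    using p(1) by (intro sum.cong) (auto simp: A_def moebius_prime_times)
  finally show ?thesis
    using False by (simp add: sum_negf)
qed simp

text \<open>This is a geometric sum whose ratio \<open>w\<close> satisfies \<open>w ^ n = 1\<close>,
  and \<open>w = 1\<close> exactly when \<open>n dvd k\<close>.\<close>

lemma sum_roots_of_unity:
  assumes "n > 0"
  shows "(\<Sum>j = 1..n. exp (2 * of_real pi * \<i> * of_nat j * of_nat k / of_nat n)) =
    (if n dvd k then of_nat n else (0 :: complex))"
proof -
  define w :: complex where "w = exp (2 * of_real pi * \<i> * of_nat k / of_nat n)"
  have cis: "w = cis (2 * pi * real k / real n)"
    by (simp add: w_def cis_conv_exp mult_ac)
  have w1: "n dvd k" if "w = 1"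
  proof -
    have "cos (2 * pi * real k / real n) = 1"
      using that by (simp add: cis complex_eq_iff)
    then obtain z :: int where "2 * pi * real k / real n = of_int z * 2 * pi"
      by (auto simp: cos_one_2pi_int)
    then have "real k = of_int z * real n"
      using assms by (simp add: field_simps)
    then have "int k = z * int n"
      by (metis of_int_eq_iff of_int_mult of_int_of_nat_eq)
    then show ?thesis
      by (metis dvd_triv_right int_dvd_int_iff)
  qed
  have pow: "exp (2 * of_real pi * \<i> * of_nat j * of_nat k / of_nat n) = w ^ j" for j
    by (simp add: w_def mult_ac flip: exp_of_nat_mult)
  have wn: "w ^ n = 1"
    using assms by (simp add: cis DeMoivre complex_eq_iff)
  show ?thesis
  proof (cases "n dvd k")
    case True
    then have "w = 1"
      using assms cos_2npi sin_2npi by (auto simp: cis complex_eq_iff mult_ac elim!: dvdE)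
    with True show ?thesis by (simp add: pow)
  next
    case False
    with w1 have "w \<noteq> 1" by blast
    \<comment> \<open>Since the sum starts at exponent 1, the numerator of the geometric sum is
      \<open>w - w ^ (n + 1)\<close>, which is 0 by \<open>wn\<close>.\<close>
    with False wn assms show ?thesis by (simp add: pow sum_gp)
  qed
qed

text \<open>The condition \<open>d dvd k\<close> sits in the summand rather than in the index set,
  so that the range of \<open>d\<close> does not depend on \<open>k\<close> and the sums over
  \<open>d\<close> and \<open>k\<close> can later be swapped.\<close>

lemma ramanujan_sum_eq_divisor_sum:
  assumes "n > 0"
  shows "ramanujan_sum n k =
    (\<Sum>d | d dvd n. if d dvd k then of_nat d * of_int (moebius (n div d)) else 0)"
proof -
  define f :: "nat \<Rightarrow> complex"
    where "f j = exp (2 * of_real pi * \<i> * of_nat j * of_nat k / of_nat n)" for j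
  have fin: "finite {e. e dvd n}"
    using assms by simp
  \<comment> \<open>Writing \<open>j = e * j'\<close> turns the sum over multiples of
    \<open>e\<close> into a full sum of roots of unity of order \<open>n div e\<close>.\<close>
  have inner: "(\<Sum>j | j \<in> {1..n} \<and> e dvd j. f j) =
      (if n div e dvd k then of_nat (n div e) else 0)" if e: "e dvd n" for e
  proof -
    obtain q where q: "n = e * q" using e by auto
    with assms have pos: "e > 0" "q > 0" by auto
    have "{j. j \<in> {1..n} \<and> e dvd j} = (*) e ` {1..q}"
      using pos by (auto simp: q)
    then have "(\<Sum>j | j \<in> {1..n} \<and> e dvd j. f j) = (\<Sum>j = 1..q. f (e * j))"
      using pos by (simp add: sum.reindex inj_on_def)
    also have "\<dots> = (\<Sum>j = 1..q. exp (2 * of_real pi * \<i> * of_nat j * of_nat k / of_nat q))"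
      using pos by (intro sum.cong refl) (simp add: f_def q field_simps)
    also have "\<dots> = (if q dvd k then of_nat q else 0)"
      using pos(2) by (rule sum_roots_of_unity)
    finally show ?thesis using pos by (simp add: q)
  qed
  have detect: "(\<Sum>e | e dvd n. if e dvd j then moebius e else 0) = (if gcd j n = 1 then 1 else 0)"
    for j
  proof -
    have "(\<Sum>e | e dvd n. if e dvd j then moebius e else 0) = (\<Sum>e | e dvd gcd j n. moebius e)"
      using fin by (auto simp: sum.inter_filter[symmetric] intro!: sum.cong)
    also have "\<dots> = (if gcd j n = 1 then 1 else 0)"
      using assms by (intro sum_moebius_divisors) simp
    finally show ?thesis .
  qed
  have "ramanujan_sum n k = (\<Sum>j\<in>{1..n}. if gcd j n = 1 then f j else 0)"
    unfolding ramanujan_sum_def f_def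
    by (subst sum.inter_filter[symmetric]) (auto intro!: sum.cong)
  also have "\<dots> = (\<Sum>j\<in>{1..n}. of_int (\<Sum>e | e dvd n. if e dvd j then moebius e else 0) * f j)"
    by (intro sum.cong refl) (simp only: detect, simp)
  also have "\<dots> = (\<Sum>j\<in>{1..n}. \<Sum>e | e dvd n. of_int (moebius e) * (if e dvd j then f j else 0))"
    unfolding of_int_sum sum_distrib_right by (intro sum.cong refl) auto
  also have "\<dots> = (\<Sum>e | e dvd n. of_int (moebius e) * (\<Sum>j | j \<in> {1..n} \<and> e dvd j. f j))"
    by (subst sum.swap) (simp only: sum_distrib_left[symmetric] sum.inter_filter finite_atLeastAtMost)
  also have "\<dots> = (\<Sum>e | e dvd n.
      of_int (moebius e) * (if n div e dvd k then of_nat (n div e) else 0))"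
    by (intro sum.cong refl) (simp only: inner mem_Collect_eq)
  also have "\<dots> = (\<Sum>d | d dvd n. if d dvd k then of_nat d * of_int (moebius (n div d)) else 0)"
    \<comment> \<open>Passing to the complementary divisor is an involution on the divisors of
      \<open>n\<close>.\<close>
    by (rule sum.reindex_bij_witness[where i = "\<lambda>d. n div d" and j = "\<lambda>d. n div d"])
      (use assms in \<open>auto simp: div_dvd_iff_mult elim!: dvdE\<close>)
  finally show ?thesis .
qed

lemma card_multiples:
  fixes l M :: nat
  assumes "l dvd M" and "M > 0"
  shows "card {k \<in> {1..M}. l dvd k} = M div l"
proof -
  obtain q where q: "M = l * q" using assms by auto
  with assms have l: "l > 0" by auto
  have "{k \<in> {1..M}. l dvd k} = (*) l ` {1..q}"
    using l by (auto simp: q)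
  with l show ?thesis
    by (simp add: q card_image inj_on_def)
qed

theorem proposition3:
  fixes r M :: nat and m :: "nat \<Rightarrow> nat"
  assumes "r \<ge> 1"
    and "\<And>i. i \<in> {1..r} \<Longrightarrow> m i \<ge> 1"
    and "M \<ge> 1"
    and "Lcm (m ` {1..r}) dvd M"
  shows "ramanujan_mean M r m =
    (\<Sum>d\<in>divisor_tuples r m.
       of_nat (\<Prod>i = 1..r. d i) / of_nat (Lcm (d ` {1..r})) *
       of_int (\<Prod>i = 1..r. moebius (m i div d i)))"
proof -
  let ?L = "\<lambda>d. Lcm (d ` {1..r})"
  \<comment> \<open>The weight of a tuple without the factor 1/lcm. It is free of \<open>k\<close>,
    so only a divisibility condition remains to be summed over \<open>k\<close>.\<close>
  define c :: "(nat \<Rightarrow> nat) \<Rightarrow> complex"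
    where "c d = of_nat (\<Prod>i = 1..r. d i) * of_int (\<Prod>i = 1..r. moebius (m i div d i))" for d
  have m: "m i > 0" if "i \<in> {1..r}" for i
    using assms(2)[OF that] by simp
  \<comment> \<open>A single \<open>d i\<close> not dividing \<open>k\<close> kills the product; all
    of them divide \<open>k\<close> exactly when their lcm does.\<close>
  have term_eq: "(\<Prod>i = 1..r. if d i dvd k then of_nat (d i) * of_int (moebius (m i div d i)) else 0)
      = (if ?L d dvd k then c d else 0)" for d k
  proof (cases "\<forall>i\<in>{1..r}. d i dvd k")
    case True
    then show ?thesis by (simp add: c_def prod.distrib)
  next
    case False
    then show ?thesis
      by (auto simp: Lcm_dvd_iff simp del: Lcm_dvd_nat intro!: prod_zero)
  qed
  have expand: "(\<Prod>i = 1..r. ramanujan_sum (m i) k) =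
      (\<Sum>d\<in>divisor_tuples r m. if ?L d dvd k then c d else 0)" for k
  proof -
    have "(\<Prod>i = 1..r. ramanujan_sum (m i) k) =
        (\<Prod>i = 1..r. \<Sum>e | e dvd m i. if e dvd k then of_nat e * of_int (moebius (m i div e)) else 0)"
      using m by (intro prod.cong refl ramanujan_sum_eq_divisor_sum)
    also have "\<dots> = (\<Sum>d\<in>divisor_tuples r m.
        \<Prod>i = 1..r. if d i dvd k then of_nat (d i) * of_int (moebius (m i div d i)) else 0)"
      \<comment> \<open>Distributivity: a product of sums is a sum over choice functions, and
        positivity of \<open>m i\<close> makes each set of divisors finite.\<close>
      unfolding divisor_tuples_def using m by (intro prod_sum_PiE) auto
    finally show ?thesis
      by (simp only: term_eq)
  qed
  \<comment> \<open>Since each \<open>d i\<close> divides \<open>m i\<close> and hence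
    \<open>M\<close>, the lcm divides \<open>M\<close>, so the number of multiples
    \<open>M div ?L d\<close> is an exact quotient and carries over to complex division.\<close>
  have count: "(\<Sum>k = 1..M. if ?L d dvd k then c d else 0) = of_nat M / of_nat (?L d) * c d"
    if d: "d \<in> divisor_tuples r m" for d
  proof -
    have "d i dvd M" if "i \<in> {1..r}" for i
    proof -
      have "d i dvd m i"
        using d that by (auto simp: divisor_tuples_def)
      also have "m i dvd M"
        using assms(4) that by (rule Lcm_dvdD[OF _ imageI])
      finally show ?thesis .
    qed
    then have L: "?L d dvd M"
      by (auto intro: Lcm_least)
    have "(\<Sum>k = 1..M. if ?L d dvd k then c d else 0) = of_nat (card {k \<in> {1..M}. ?L d dvd k}) * c d"
      by (simp only: sum.inter_filter[symmetric] finite_atLeastAtMost sum_constant)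
    also have "card {k \<in> {1..M}. ?L d dvd k} = M div ?L d"
      using L assms(3) by (intro card_multiples) auto
    finally show ?thesis
      using L by (simp only: of_nat_of_nat_div)
  qed
  have "ramanujan_mean M r m =
      1 / of_nat M * (\<Sum>d\<in>divisor_tuples r m. \<Sum>k = 1..M. if ?L d dvd k then c d else 0)"
    unfolding ramanujan_mean_def expand by (subst sum.swap) (rule refl)
  also have "\<dots> = (\<Sum>d\<in>divisor_tuples r m. c d / of_nat (?L d))"
    unfolding sum_distrib_left[of "1 / of_nat M" _ "divisor_tuples r m"]
  proof (intro sum.cong refl)
    fix d assume "d \<in> divisor_tuples r m"
    then show "1 / of_nat M * (\<Sum>k = 1..M. if ?L d dvd k then c d else 0) = c d / of_nat (?L d)"
      using assms(3) by (simp only: count) simp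
  qed
  finally show ?thesis
    by (simp only: c_def times_divide_eq_left)
qed

end
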